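(* For $x,y,z,w\in\mathbb{Z}$ let $$N(x,y,z,w)=x^4+(4wy+2z^2)x^2+(-4zy^2+4w^2z)x+(y^4+2w^2y^2-4wz^2y+z^4+w^4).$$ Suppose that an integer $n\equiv 0\pmod{196}$ cannot be represented as the sum of a value $N(x,y,z,w)$ with $x,y,z,w\in\mathbb{Z}$ and at most three powers of $2$. Then, for every integer $a\geq 0$, the integer $2^a n$ also cannot be represented as the sum of a value $N(x,y,z,w)$ with $x,y,z,w\in\mathbb{Z}$ and at most three powers of $2$.
   Context: $N(x,y,z,w)$ is the norm of the element $x+y\zeta+z\zeta^2+w\zeta^3$ of $\mathbb{Z}[\zeta]$, where $\zeta=\exp(2\pi i/8)$. A power of $2$ means $2^b$ with $b\geq 0$ an integer (so $1$ is a power of $2$). Powers may be repeated in a sum, and "at most three" includes using no powers. *)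

theory Defs
  imports "HOL-Number_Theory.Cong"
begin

(* The norm of x + y*zeta + z*zeta^2 + w*zeta^3 from the ring of integers of Q(zeta) to the
   integers, where zeta = exp(2 pi i / 8), written out as a polynomial. *)
definition N :: "int \<Rightarrow> int \<Rightarrow> int \<Rightarrow> int \<Rightarrow> int" where
  "N x y z w =
     x^4 + (4*w*y + 2*z^2) * x^2 + (- 4*z*y^2 + 4*w^2*z) * x
     + (y^4 + 2*w^2*y^2 - 4*w*z^2*y + z^4 + w^4)"

(* The list bs holds the exponents of the powers of 2 used; repetitions and the empty list
   are allowed. *)
definition norm_plus_three_powers :: "int \<Rightarrow> bool" where
  "norm_plus_three_powers n \<longleftrightarrow>
     (\<exists>x y z w. \<exists>bs :: nat list. length bs \<le> 3 \<and> n = N x y z w + (\<Sum>b\<leftarrow>bs. 2 ^ b))"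

end

theory Submission
  imports Defs
begin

text \<open>
  It suffices to descend from \<open>2 m\<close> to \<open>m\<close> when \<open>196\<close> divides \<open>m\<close>. If the norm is even, then
  \<open>1 + \<zeta>\<close>, an element of norm \<open>2\<close>, can be divided out, and the powers of two can be halved as
  well. An odd norm is \<open>1\<close> modulo \<open>8\<close>, so the powers add up to \<open>7\<close> modulo \<open>8\<close>; three powers
  achieve this only as \<open>1 + 2 + 4\<close>. Then \<open>7\<close> divides the norm, which is a sum of two
  squares (it is a norm from \<open>\<int>[i]\<close>), so \<open>49\<close> divides the norm and hence \<open>7\<close>, which is absurd.
\<close>

text \<open>With \<open>i = \<zeta>^2\<close>, the relative norm to the Gaussian integers is
  \<open>(x + z i)^2 - i (y + w i)^2\<close>; its real and imaginary parts are the two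
  bases.\<close>

lemma N_sum_of_squares:
  "N x y z w = (x\<^sup>2 - z\<^sup>2 + 2*y*w)\<^sup>2 + (2*x*z - y\<^sup>2 + w\<^sup>2)\<^sup>2"
  by (simp add: N_def) algebra

text \<open>The left-hand side is the norm of \<open>(1 + \<zeta>) (a + b \<zeta> + c \<zeta>\<^sup>2 + d \<zeta>\<^sup>3)\<close>.\<close>

lemma N_mult_one_plus_zeta: "N (a - d) (a + b) (b + c) (c + d) = 2 * N a b c d"
  by (simp add: N_def) algebra

lemma even_N_iff: "even (N x y z w) \<longleftrightarrow> even (x + y + z + w)"
  by (auto simp: N_sum_of_squares)

lemma even_N_half:
  assumes "even (N x y z w)"
  obtains a b c d where "N x y z w = 2 * N a b c d"
proof -
  have "even (x + y - z + w)"
    using assms by (simp add: even_N_iff)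
  \<comment> \<open>Solving \<open>x = a - d\<close>, \<open>y = a + b\<close>,
    \<open>z = b + c\<close>, \<open>w = c + d\<close> gives \<open>x + y - z + w = 2 * a\<close>,
    and then \<open>b\<close>, \<open>c\<close>, \<open>d\<close> in turn.\<close>
  then obtain a where "x + y - z + w = 2 * a" ..
  then have "x = a - (w - (z - (y - a)))"
    by simp
  then have "N x y z w = 2 * N a (y - a) (z - (y - a)) (w - (z - (y - a)))"
    using N_mult_one_plus_zeta[of a "w - (z - (y - a))" "y - a" "z - (y - a)"] by simp
  then show thesis ..
qed

lemma odd_square_mod_8:
  fixes p :: int
  assumes "odd p"
  shows "p\<^sup>2 mod 8 = 1"
proof -
  obtain k where "p = 2 * k + 1"
    using assms ..
  then have "p\<^sup>2 = 4 * (k * (k + 1)) + 1"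
    by algebra
  moreover obtain j where "k * (k + 1) = 2 * j"
    by (rule evenE[of "k * (k + 1)"]) auto
  ultimately have "p\<^sup>2 = 1 + j * 8"
    by simp
  then show ?thesis
    by simp
qed

lemma odd_plus_mult4_square_mod_8:
  fixes p q :: int
  assumes "odd p" and "4 dvd q"
  shows "(p\<^sup>2 + q\<^sup>2) mod 8 = 1"
proof -
  obtain k where "q = 4 * k"
    using \<open>4 dvd q\<close> ..
  then have "q\<^sup>2 = 8 * (2 * k\<^sup>2)"
    by algebra
  with odd_square_mod_8[OF \<open>odd p\<close>] show ?thesis
    by presburger
qed

lemma four_dvd_diff_squares:
  fixes p q :: int
  assumes "even (p + q)"
  shows "4 dvd p\<^sup>2 - q\<^sup>2"
proof -
  have "2 * 2 dvd (p + q) * (p - q)"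
    using assms by (intro mult_dvd_mono) auto
  then show ?thesis
    by (simp add: power2_eq_square algebra_simps)
qed

lemma four_dvd_double_mult:
  fixes p q :: int
  assumes "odd (p + q)"
  shows "4 dvd 2 * p * q"
proof -
  have "2 * 2 dvd 2 * (p * q)"
    using assms by (intro mult_dvd_mono) auto
  then show ?thesis
    by (simp add: mult.assoc)
qed

text \<open>Exactly one of \<open>x + z\<close> and \<open>y + w\<close> is odd. Either way, one of
  the two squared bases is odd and the other is a multiple of 4.\<close>

lemma odd_N_mod_8:
  assumes "odd (N x y z w)"
  shows "N x y z w mod 8 = 1"
proof -
  let ?p = "x\<^sup>2 - z\<^sup>2 + 2*y*w" and ?q = "2*x*z - y\<^sup>2 + w\<^sup>2"
  have parity: "odd (x + y + z + w)"
    using assms by (simp add: even_N_iff)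
  show ?thesis
  proof (cases "even (x + z)")
    case True
    with parity have "odd (y + w)"
      by presburger
    with True have "4 dvd ?p"
      by (rule dvd_add[OF four_dvd_diff_squares four_dvd_double_mult])
    moreover have "odd ?q"
      using \<open>odd (y + w)\<close> by simp
    ultimately show ?thesis
      using odd_plus_mult4_square_mod_8[of ?q ?p] by (simp add: N_sum_of_squares add.commute)
  next
    case False
    with parity have "even (w + y)"
      by presburger
    with False have "4 dvd 2*x*z + (w\<^sup>2 - y\<^sup>2)"
      by (rule dvd_add[OF four_dvd_double_mult four_dvd_diff_squares])
    then have "4 dvd ?q"
      by (simp add: algebra_simps)
    moreover have "odd ?p"
      using False by simp
    ultimately show ?thesis
      using odd_plus_mult4_square_mod_8[of ?p ?q] by (simp add: N_sum_of_squares)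
  qed
qed

text \<open>As -1 is not a square modulo 7, both \<open>p\<close> and \<open>q\<close> must be
  multiples of 7.\<close>

lemma seven_dvd_sum_of_squares:
  fixes p q :: int
  assumes "7 dvd p\<^sup>2 + q\<^sup>2"
  shows "49 dvd p\<^sup>2 + q\<^sup>2"
proof -
  have residue: "r mod 7 \<in> {0, 1, 2, 3, 4, 5, 6}" for r :: int
    using pos_mod_bound[of 7 r] pos_mod_sign[of 7 r] by (simp; presburger)
  have "((p mod 7)\<^sup>2 + (q mod 7)\<^sup>2) mod 7 = (p\<^sup>2 + q\<^sup>2) mod 7"
    using mod_add_eq[of "(p mod 7)\<^sup>2" 7 "(q mod 7)\<^sup>2"] mod_add_eq[of "p\<^sup>2" 7 "q\<^sup>2"]
    by (simp only: power_mod)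
  then have square_sum: "((p mod 7)\<^sup>2 + (q mod 7)\<^sup>2) mod 7 = 0"
    using assms by (simp only: dvd_eq_mod_eq_0)
  have residues: "a = 0 \<and> b = 0"
    if "a \<in> {0, 1, 2, 3, 4, 5, 6}" "b \<in> {0, 1, 2, 3, 4, 5, 6}" "(a\<^sup>2 + b\<^sup>2) mod 7 = 0" for a b :: int
    using that by auto
  have "p mod 7 = 0 \<and> q mod 7 = 0"
    using residues[OF residue residue square_sum] .
  then have "7\<^sup>2 dvd p\<^sup>2" and "7\<^sup>2 dvd q\<^sup>2"
    by (auto intro!: dvd_power_same)
  then show ?thesis
    by simp
qed

lemma list_length_le_3_cases:
  assumes "length xs \<le> 3"
  obtains "xs = []" | a where "xs = [a]" | a b where "xs = [a, b]" | a b c where "xs = [a, b, c]"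
proof -
  have "length xs = 0 \<or> length xs = 1 \<or> length xs = 2 \<or> length xs = 3"
    using assms by linarith
  then show thesis
    using that by (auto simp: length_Suc_conv numeral_eq_Suc)
qed

text \<open>The term 1 occurs zero or two times. A pair 1 + 1 halves to the single power
  \<open>2 ^ 0\<close>, and every other exponent drops by one, so the list never grows.\<close>

lemma power2_sum_half:
  fixes bs :: "nat list"
  assumes "length bs \<le> 3" and "even (\<Sum>b\<leftarrow>bs. 2 ^ b :: int)"
  obtains cs :: "nat list"
    where "length cs \<le> 3" and "(\<Sum>b\<leftarrow>bs. 2 ^ b :: int) = 2 * (\<Sum>c\<leftarrow>cs. 2 ^ c)"
proof -
  have pred: "b = 0 \<or> (\<exists>c. b = Suc c)" for b :: nat
    by (cases b) auto
  from \<open>length bs \<le> 3\<close> show thesis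
  proof (cases rule: list_length_le_3_cases)
    case 1
    then show thesis
      using that[of "[]"] by simp
  next
    case (2 a)
    then show thesis
      using assms(2) pred[of a] that[of "[a - 1]"] by auto
  next
    case (3 a b)
    then show thesis
      using assms(2) pred[of a] pred[of b] that[of "[0]"] that[of "[a - 1, b - 1]"] by auto
  next
    case (4 a b c)
    then show thesis
      using assms(2) pred[of a] pred[of b] pred[of c]
        that[of "[0, a - 1]"] that[of "[0, b - 1]"] that[of "[0, c - 1]"]
        that[of "[a - 1, b - 1, c - 1]"]
      by auto
  qed
qed

text \<open>Modulo 8 a power of 2 is 0, 1, 2 or 4, and three such residues reach 7 only as 1 + 2 +
  4. A nonzero residue determines the power.\<close>

lemma power2_sum_mod_8_eq_7:
  fixes bs :: "nat list"
  assumes "length bs \<le> 3" and "(\<Sum>b\<leftarrow>bs. 2 ^ b :: int) mod 8 = 7"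
  shows "(\<Sum>b\<leftarrow>bs. 2 ^ b :: int) = 7"
proof -
  \<comment> \<open>\<open>P\<close> covers the powers of 2 and also 0, so that shorter lists can be
    padded to three summands.\<close>
  define P where "P s \<longleftrightarrow> s mod 8 \<in> {0, 1, 2, 4} \<and> (s mod 8 = 0 \<or> s mod 8 = s)" for s :: int
  have P_zero: "P 0"
    by (simp add: P_def)
  have P_power: "P (2 ^ b)" for b :: nat
  proof (cases "b < 3")
    case True
    then have "b = 0 \<or> b = 1 \<or> b = 2"
      by linarith
    then show ?thesis
      by (auto simp: P_def)
  next
    case False
    then have "(2 ^ 3 :: int) dvd 2 ^ b"
      by (intro le_imp_power_dvd) simp
    then show ?thesis
      by (simp add: P_def)
  qed
  have residues: "i \<noteq> 0 \<and> j \<noteq> 0 \<and> k \<noteq> 0 \<and> i + (j + k) = 7"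
    if "i \<in> {0, 1, 2, 4}" "j \<in> {0, 1, 2, 4}" "k \<in> {0, 1, 2, 4}" "(i + (j + k)) mod 8 = 7"
    for i j k :: int
    using that by auto
  have sum_eq_7: "s + (t + u) = 7" if "P s" "P t" "P u" "(s + (t + u)) mod 8 = 7" for s t u
  proof -
    have "(s mod 8 + (t mod 8 + u mod 8)) mod 8 = (s + (t + u)) mod 8"
      by (subst mod_add_right_eq[symmetric]) (simp only: mod_add_eq)
    then have "(s mod 8 + (t mod 8 + u mod 8)) mod 8 = 7"
      using that(4) by (rule trans)
    then show ?thesis
      using that(1-3) residues[of "s mod 8" "t mod 8" "u mod 8"] unfolding P_def by metis
  qed
  from \<open>length bs \<le> 3\<close> show ?thesis
  proof (cases rule: list_length_le_3_cases)
    case 1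
    then show ?thesis
      using assms(2) by simp
  next
    case (2 a)
    then show ?thesis
      using assms(2) sum_eq_7[OF P_power[of a] P_zero P_zero] by simp
  next
    case (3 a b)
    then show ?thesis
      using assms(2) sum_eq_7[OF P_power[of a] P_power[of b] P_zero] by simp
  next
    case (4 a b c)
    then show ?thesis
      using assms(2) sum_eq_7[OF P_power[of a] P_power[of b] P_power[of c]] by simp
  qed
qed

lemma norm_plus_three_powers_half:
  assumes "196 dvd m" and "norm_plus_three_powers (2 * m)"
  shows "norm_plus_three_powers m"
proof -
  obtain x y z w and bs :: "nat list" where bs: "length bs \<le> 3"
    and eq: "2 * m = N x y z w + (\<Sum>b\<leftarrow>bs. 2 ^ b)"
    using assms(2) unfolding norm_plus_three_powers_def by blast
  let ?S = "\<Sum>b\<leftarrow>bs. 2 ^ b :: int"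
  show ?thesis
  proof (cases "even (N x y z w)")
    case True
    then have "even ?S"
      using eq by presburger
    with bs obtain cs :: "nat list"
      where cs: "length cs \<le> 3" "?S = 2 * (\<Sum>c\<leftarrow>cs. 2 ^ c)"
      by (rule power2_sum_half)
    obtain a b c d where "N x y z w = 2 * N a b c d"
      using True by (rule even_N_half)
    then have "m = N a b c d + (\<Sum>c\<leftarrow>cs. 2 ^ c)"
      using eq cs(2) by linarith
    then show ?thesis
      unfolding norm_plus_three_powers_def using cs(1) by blast
  next
    case False
    then have "N x y z w mod 8 = 1"
      by (rule odd_N_mod_8)
    then have "N x y z w = 8 * (N x y z w div 8) + 1"
      using mult_div_mod_eq[of 8 "N x y z w"] by simp
    moreover obtain k where k: "m = 196 * k"
      using assms(1) ..
    \<comment> \<open>As 4 divides 196, \<open>2 * m\<close> is a multiple of 8; this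
      \<open>d\<close> is the quotient left once the residue -1 is written as 7 - 8.\<close>
    moreover define d where "d = 49 * k - N x y z w div 8 - 1"
    ultimately have "?S = 7 + d * 8"
      using eq by linarith
    then have "?S mod 8 = 7"
      by simp
    with bs have "?S = 7"
      by (rule power2_sum_mod_8_eq_7)
    with eq k have N_eq: "N x y z w = 392 * k - 7"
      by simp
    \<comment> \<open>Since 392 is 8 * 49, the norm is -7 modulo 49: a multiple of 7 but not of
      49.\<close>
    then have "N x y z w = 7 * (56 * k - 1)"
      by simp
    then have "7 dvd N x y z w" ..
    then have "49 dvd N x y z w"
      unfolding N_sum_of_squares by (rule seven_dvd_sum_of_squares)
    with N_eq have False
      by presburger
    then show ?thesis ..
  qed
qed

theorem lemma2:
  fixes n :: int
  assumes "[n = 0] (mod 196)"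
    and "\<not> norm_plus_three_powers n"
  shows "\<forall>a::nat. \<not> norm_plus_three_powers (2 ^ a * n)"
proof
  fix a :: nat
  have "196 dvd n"
    using assms(1) by (simp add: cong_0_iff)
  show "\<not> norm_plus_three_powers (2 ^ a * n)"
  proof (induction a)
    case 0
    then show ?case
      using assms(2) by simp
  next
    case (Suc a)
    \<comment> \<open>Doubling preserves divisibility by 196, so the halving lemma applies, in
      contrapositive form, at every step.\<close>
    have "196 dvd 2 ^ a * n"
      using \<open>196 dvd n\<close> by simp
    with Suc show ?case
      using norm_plus_three_powers_half by (auto simp: mult.assoc)
  qed
qed

end
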